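(* Let $N=\{1,\dots,n\}$ be a set of players and let $k\in\{2,\dots,n-1\}$. For every $k$-game $v$ on $N$ the Gately value coincides with the Shapley value: $g(v)=\phi(v)$.
   Context: A cooperative game on $N$ is a function $v\colon 2^N\to\mathbb R$ with $v(\varnothing)=0$. Write $v_i=v(\{i\})$ and $M_i(v)=v(N)-v(N\setminus\{i\})$ for $i\in N$. The game $v$ is regular if: (essential) $\sum_{j\in N}v_j\leqslant v(N)\leqslant\sum_{j\in N}M_j(v)$; and (standard) $v_i\leqslant M_i(v)$ for every $i\in N$, with $v_j<M_j(v)$ for at least one $j\in N$. For nonempty $S\subseteq N$ the unanimity game $u_S$ is given by $u_S(T)=1$ if $S\subseteq T$ and $u_S(T)=0$ otherwise. Every game $v$ can be written uniquely as $v=\sum_{\varnothing\neq S\subseteq N}\Delta_v(S)\,u_S$ with Harsanyi dividends $\Delta_v(S)=\sum_{T\subseteq S}(-1)^{|S|-|T|}v(T)$. Let $\Pi_v=\{S\subseteq N\mid S\neq\varnothing,\ \Delta_v(S)\neq0\}$. The game $v$ is a $k$-game if $v$ is regular and $|S|=k$ for all $S\in\Pi_v$. The Shapley value is $\phi_i(v)=\sum_{S\subseteq N\colon i\in S}\frac{\Delta_v(S)}{|S|}$, $i\in N$. The Gately value of a regular game is $$g_i(v)=v_i+\frac{M_i(v)-v_i}{\sum_{j\in N}(M_j(v)-v_j)}\Big(v(N)-\sum_{j\in N}v_j\Big),\qquad i\in N.$$ *)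

theory Defs
  imports Complex_Main
begin

text \<open>
  A game on a finite player set \<open>N\<close> is represented by a total function on all sets of players;
  every notion below inspects it only on subsets of \<open>N\<close>.
\<close>

type_synonym 'p game = "'p set \<Rightarrow> real"

definition coop_game :: "'p game \<Rightarrow> bool" where
  "coop_game v \<longleftrightarrow> v {} = 0"

definition marginal :: "'p set \<Rightarrow> 'p game \<Rightarrow> 'p \<Rightarrow> real" where
  "marginal N v i = v N - v (N - {i})"

definition essential :: "'p set \<Rightarrow> 'p game \<Rightarrow> bool" where
  "essential N v \<longleftrightarrow> (\<Sum>j\<in>N. v {j}) \<le> v N \<and> v N \<le> (\<Sum>j\<in>N. marginal N v j)"

definition standard_game :: "'p set \<Rightarrow> 'p game \<Rightarrow> bool" where
  "standard_game N v \<longleftrightarrow>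
     (\<forall>i\<in>N. v {i} \<le> marginal N v i) \<and> (\<exists>j\<in>N. v {j} < marginal N v j)"

definition regular_game :: "'p set \<Rightarrow> 'p game \<Rightarrow> bool" where
  "regular_game N v \<longleftrightarrow> coop_game v \<and> essential N v \<and> standard_game N v"

text \<open>
  The subtraction in the exponent is on \<open>nat\<close>, but never truncates: \<open>T \<subseteq> S\<close> and \<open>S\<close> is finite.
\<close>

definition dividend :: "'p game \<Rightarrow> 'p set \<Rightarrow> real" where
  "dividend v S = (\<Sum>T\<in>Pow S. (- 1) ^ (card S - card T) * v T)"

definition productive :: "'p set \<Rightarrow> 'p game \<Rightarrow> 'p set set" where
  "productive N v = {S. S \<subseteq> N \<and> S \<noteq> {} \<and> dividend v S \<noteq> 0}"

definition k_game :: "nat \<Rightarrow> 'p set \<Rightarrow> 'p game \<Rightarrow> bool" where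
  "k_game k N v \<longleftrightarrow> regular_game N v \<and> (\<forall>S\<in>productive N v. card S = k)"

definition shapley :: "'p set \<Rightarrow> 'p game \<Rightarrow> 'p \<Rightarrow> real" where
  "shapley N v i = (\<Sum>S\<in>{S. S \<subseteq> N \<and> i \<in> S}. dividend v S / real (card S))"

text \<open>
  For regular games the denominator is positive, by the strict inequality in \<open>standard_game\<close>.
\<close>

definition gately :: "'p set \<Rightarrow> 'p game \<Rightarrow> 'p \<Rightarrow> real" where
  "gately N v i = v {i} + (marginal N v i - v {i}) / (\<Sum>j\<in>N. marginal N v j - v {j})
                           * (v N - (\<Sum>j\<in>N. v {j}))"

end

theory Submission
  imports Defs
begin

text \<open>
  By Moebius inversion \<open>v\<close> is the sum of its dividends, so in a \<open>k\<close>-game with \<open>k \<ge> 2\<close> all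
  singletons are worth \<open>0\<close> and each marginal contribution is \<open>k\<close> times the Shapley value. As the
  Shapley value is efficient, the marginal contributions add up to \<open>k\<close> times the worth of the
  grand coalition, which turns the Gately value into the marginal contribution divided by \<open>k\<close>.
\<close>

lemma dividend_empty: "dividend v {} = v {}"
  by (simp add: dividend_def)

text \<open>Moebius inversion on the subset lattice, obtained from the symmetric form of
  inclusion-exclusion.\<close>

lemma sum_dividend:
  assumes "finite S"
  shows "(\<Sum>T\<in>Pow S. dividend v T) = v S"
proof -
  \<comment> \<open>The sign twist makes the transform between \<open>v\<close> and \<open>f\<close>
    an involution: both directions carry the sign \<open>(-1) ^ card T\<close>.\<close>
  define f where "f S = (-1) ^ card S * dividend v S" for S
  have "f A = (\<Sum>T\<in>Pow A. (-1) ^ card T * v T)" if "finite A" for A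
    unfolding f_def dividend_def sum_distrib_left
  proof (intro sum.cong refl)
    fix T assume "T \<in> Pow A"
    then have "card T \<le> card A"
      using that by (simp add: card_mono)
    \<comment> \<open>The two exponents add up to \<open>card T + 2 * d\<close>, which has the
      parity of \<open>card T\<close>.\<close>
    then obtain d where "card A = card T + d"
      using le_Suc_ex by blast
    then show "(-1) ^ card A * ((-1) ^ (card A - card T) * v T) = (-1) ^ card T * v T"
      by (simp add: minus_one_power_iff)
  qed
  then have "v S = (\<Sum>T\<in>Pow S. (-1) ^ card T * f T)"
    using inclusion_exclusion_symmetric[of f v S] assms by blast
  then show ?thesis
    by (simp add: f_def flip: mult.assoc power_add)
qed

text \<open>In the difference of worths the dividends of coalitions avoiding \<open>i\<close>
  cancel.\<close>

lemma marginal_eq_sum_dividend: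
  assumes "finite N"
  shows "marginal N v i = (\<Sum>S\<in>{S. S \<subseteq> N \<and> i \<in> S}. dividend v S)"
proof -
  have "Pow N = Pow (N - {i}) \<union> {S. S \<subseteq> N \<and> i \<in> S}" by auto
  then have "sum (dividend v) (Pow N) =
      sum (dividend v) (Pow (N - {i})) + (\<Sum>S\<in>{S. S \<subseteq> N \<and> i \<in> S}. dividend v S)"
    using assms by (simp only:) (rule sum.union_disjoint, auto)
  then show ?thesis
    using assms by (simp add: marginal_def sum_dividend)
qed

text \<open>Efficiency: each nonempty coalition splits its dividend equally among its members, so
  exchanging the sums recovers every dividend once.\<close>

lemma sum_shapley:
  assumes "finite N" and "v {} = 0"
  shows "(\<Sum>i\<in>N. shapley N v i) = v N"
proof -
  have "(\<Sum>i\<in>N. shapley N v i) =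
      (\<Sum>i\<in>N. \<Sum>S | S \<in> Pow N \<and> i \<in> S. dividend v S / real (card S))"
    by (simp add: shapley_def)
  also have "\<dots> = (\<Sum>S\<in>Pow N. \<Sum>i | i \<in> N \<and> i \<in> S. dividend v S / real (card S))"
    using assms(1) by (intro sum.swap_restrict) auto
  also have "\<dots> = (\<Sum>S\<in>Pow N. dividend v S)"
  proof (intro sum.cong refl)
    fix S assume "S \<in> Pow N"
    then have "{i. i \<in> N \<and> i \<in> S} = S" and "finite S"
      using assms(1) finite_subset by auto
    then show "(\<Sum>i | i \<in> N \<and> i \<in> S. dividend v S / real (card S)) = dividend v S"
      \<comment> \<open>For \<open>S = {}\<close> the inner sum is empty, and the dividend is
        \<open>v {} = 0\<close>.\<close>
      using assms(2) by (cases "S = {}") (auto simp: dividend_empty)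
  qed
  finally show ?thesis
    using assms(1) by (simp add: sum_dividend)
qed

text \<open>The empty coalition, excluded from \<open>productive\<close>, is covered because its
  dividend is \<open>v {}\<close>.\<close>

lemma k_game_dividend_eq_0:
  assumes "k_game k N v" and "S \<subseteq> N" and "card S \<noteq> k"
  shows "dividend v S = 0"
  using assms
  by (cases "S = {}")
     (auto simp: k_game_def productive_def regular_game_def coop_game_def dividend_empty)

lemma k_game_singleton:
  assumes "k_game k N v" and "2 \<le> k" and "i \<in> N"
  shows "v {i} = 0"
proof -
  have "v {i} = (\<Sum>S\<in>Pow {i}. dividend v S)"
    by (simp add: sum_dividend)
  also have "\<dots> = 0"
  proof (intro sum.neutral ballI)
    fix S assume S: "S \<in> Pow {i}"
    then have "card S \<le> 1"
      using card_mono[of "{i}" S] by simp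
    then show "dividend v S = 0"
      using S assms by (intro k_game_dividend_eq_0[OF assms(1)]) auto
  qed
  finally show ?thesis .
qed

text \<open>Only coalitions of size \<open>k\<close> contribute, so all the Shapley weights that
  matter equal \<open>1 / k\<close>.\<close>

lemma k_game_marginal:
  assumes "finite N" and "k_game k N v" and "0 < k"
  shows "marginal N v i = real k * shapley N v i"
  unfolding marginal_eq_sum_dividend[OF assms(1)] shapley_def sum_distrib_left
proof (intro sum.cong refl)
  fix S assume "S \<in> {S. S \<subseteq> N \<and> i \<in> S}"
  then show "dividend v S = real k * (dividend v S / real (card S))"
    using assms k_game_dividend_eq_0[of k N v S] by (cases "card S = k") auto
qed

lemma k_game_gately_eq_shapley:
  assumes "finite N" and "k_game k N v" and "2 \<le> k" and "i \<in> N"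
  shows "gately N v i = shapley N v i"
proof -
  have std: "standard_game N v" and "v {} = 0"
    using assms(2) by (auto simp: k_game_def regular_game_def coop_game_def)
  have single: "v {j} = 0" if "j \<in> N" for j
    using k_game_singleton[OF assms(2,3) that] .
  have marg: "marginal N v j = real k * shapley N v j" for j
    using assms by (intro k_game_marginal) auto
  have denom: "(\<Sum>j\<in>N. marginal N v j - v {j}) = real k * v N"
    using sum_shapley[of N v] assms(1) \<open>v {} = 0\<close>
    by (simp add: single marg flip: sum_distrib_left)
  obtain j where "j \<in> N" "v {j} < marginal N v j"
    using std by (auto simp: standard_game_def)
  then have "0 < (\<Sum>j\<in>N. marginal N v j - v {j})"
    using std assms(1) by (intro sum_pos2[of N j]) (auto simp: standard_game_def)
  \<comment> \<open>This allows \<open>v N\<close> to be cancelled in the Gately fraction.\<close>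
  then have "v N \<noteq> 0"
    using denom by auto
  then show ?thesis
    unfolding gately_def denom using assms(3,4) by (simp add: single marg)
qed

theorem theorem5p9:
  fixes n k :: nat and v :: "nat game"
  assumes "k \<in> {2..n - 1}"
    and "k_game k {1..n} v"
  shows "\<forall>i\<in>{1..n}. gately {1..n} v i = shapley {1..n} v i"
  using assms k_game_gately_eq_shapley[of "{1..n}" k v] by auto

end
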